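(* For each $n\in\{2,3\}$ there exist $p\in[0,1]$ and $\pm1$-valued observables $A_0,A_1$ on Alice's $n$ qubits and $B_0,B_1$ on Bob's $n$ qubits such that the CHSH value of $n$ copies of the bipartite pure state $|\Psi_p\rangle=\sqrt{p}\,|\psi\rangle+\sqrt{1-p}\,|\phi\rangle$ strictly exceeds the CHSH value of optimal entanglement distillation: $$\langle\Psi_p|^{\otimes n}\bigl(A_0\otimes B_0+A_0\otimes B_1+A_1\otimes B_0-A_1\otimes B_1\bigr)|\Psi_p\rangle^{\otimes n}\;>\;V_{ED}(n,p),$$ where $V_{ED}(n,p)=2\sqrt2\,p_{\mathrm{succ}}(n,p)+2\bigl(1-p_{\mathrm{succ}}(n,p)\bigr)$ and $p_{\mathrm{succ}}(n,p)$ is the optimal probability of distilling a Bell state from $|\Psi_p\rangle^{\otimes n}$.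
   Context: Bell states: $|\psi\rangle=\frac1{\sqrt2}(|00\rangle+|11\rangle)$ and $|\phi\rangle=\frac1{\sqrt2}(|01\rangle+|10\rangle)$ in $\mathbb C^2\otimes\mathbb C^2$, the first qubit held by Alice and the second by Bob. In $n$ copies, Alice holds the $n$ first qubits and Bob the $n$ second qubits, so that $|\Psi_p\rangle^{\otimes n}$ is regarded as a vector in $(\mathbb C^2)^{\otimes n}\otimes(\mathbb C^2)^{\otimes n}$ (Alice $\otimes$ Bob). A $\pm1$-valued observable on $(\mathbb C^2)^{\otimes n}$ is a Hermitian operator $A$ with $A^2=\mathbb 1$. Nonlocality distillation means that Alice and Bob, without communicating, directly perform collective measurements of such observables on their shares of the $n$ copies. Optimal entanglement distillation: $p_{\mathrm{succ}}(n,p)$ is the maximal probability with which Alice and Bob can convert $|\Psi_p\rangle^{\otimes n}$ into the Bell state $|\psi\rangle$ by local operations and classical communication. On failure the resulting state is a product state, with CHSH value $2$; on success the CHSH value is $2\sqrt2$. This gives the weighted average $V_{ED}$. By a known result of Lo and Popescu (which may be taken as the definition of $p_{\mathrm{succ}}$ here), if $\lambda_1\ge\lambda_2\ge\dots\ge\lambda_{2^n}$ are the squared Schmidt coefficients of $|\Psi_p\rangle^{\otimes n}$ (so $\sum_i\lambda_i=1$), then $$p_{\mathrm{succ}}(n,p)=\min_{1\le r\le2}\frac2r\sum_{i=3-r}^{2^n}\lambda_i=\min\{1,\,2(1-\lambda_1)\}.$$ The squared Schmidt coefficients of a single copy $|\Psi_p\rangle$ are $\left(\frac{\sqrt p+\sqrt{1-p}}{\sqrt2}\right)^2$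 and $\left(\frac{\sqrt p-\sqrt{1-p}}{\sqrt2}\right)^2$, and the $\lambda_i$ are all $n$-fold products of these, sorted in decreasing order; in particular $\lambda_1=\left(\frac{\sqrt p+\sqrt{1-p}}{\sqrt2}\right)^{2n}$. *)

theory Defs
  imports Complex_Main "Jordan_Normal_Form.Schur_Decomposition"
begin

text \<open>Vectors and operators are complex vectors and matrices with respect to the computational
  basis. The product basis is ordered lexicographically: the basis vector \<open>|i\<rangle> \<otimes> |j\<rangle>\<close>, with the second
  factor of dimension \<open>d\<close>, has index \<open>i * d + j\<close>.\<close>

definition tensor_vec :: "complex vec \<Rightarrow> complex vec \<Rightarrow> complex vec" where
  "tensor_vec u v =
     vec (dim_vec u * dim_vec v) (\<lambda>k. u $ (k div dim_vec v) * v $ (k mod dim_vec v))"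

definition tensor_mat :: "complex mat \<Rightarrow> complex mat \<Rightarrow> complex mat" where
  "tensor_mat A B =
     mat (dim_row A * dim_row B) (dim_col A * dim_col B)
       (\<lambda>(k, l). A $$ (k div dim_row B, l div dim_col B) * B $$ (k mod dim_row B, l mod dim_col B))"

definition ket2 :: "nat \<Rightarrow> nat \<Rightarrow> complex vec" where
  "ket2 a b = tensor_vec (unit_vec 2 a) (unit_vec 2 b)"

definition bell_psi :: "complex vec" where
  "bell_psi = complex_of_real (1 / sqrt 2) \<cdot>\<^sub>v (ket2 0 0 + ket2 1 1)"

definition bell_phi :: "complex vec" where
  "bell_phi = complex_of_real (1 / sqrt 2) \<cdot>\<^sub>v (ket2 0 1 + ket2 1 0)"

definition Psi :: "real \<Rightarrow> complex vec" where
  "Psi p = complex_of_real (sqrt p) \<cdot>\<^sub>v bell_psi + complex_of_real (sqrt (1 - p)) \<cdot>\<^sub>v bell_phi"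

text \<open>The vector \<open>n_copies n v\<close> is the \<open>n\<close>-th tensor power of the two-qubit vector \<open>v\<close>, with the tensor
  factors regrouped as (all first qubits) \<open>\<otimes>\<close> (all second qubits). If Alice's basis index \<open>i\<close> has
  binary digits \<open>i\<^sub>k\<close> and Bob's basis index \<open>j\<close> has binary digits \<open>j\<^sub>k\<close>, the amplitude of
  \<open>|i\<rangle> \<otimes> |j\<rangle>\<close> is the product over \<open>k\<close> of the amplitudes of \<open>|i\<^sub>k j\<^sub>k\<rangle>\<close> in \<open>v\<close>. Here the \<open>k\<close>-th digit
  is counted from the least significant one; the order in which the copies are counted does not
  affect the result, since they are identical.\<close>

definition bit_of :: "nat \<Rightarrow> nat \<Rightarrow> nat" where
  "bit_of i k = (i div 2 ^ k) mod 2"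

definition n_copies :: "nat \<Rightarrow> complex vec \<Rightarrow> complex vec" where
  "n_copies n v =
     vec (2 ^ n * 2 ^ n)
       (\<lambda>m. \<Prod>k<n. v $ (2 * bit_of (m div 2 ^ n) k + bit_of (m mod 2 ^ n) k))"

definition pm1_observable :: "nat \<Rightarrow> complex mat \<Rightarrow> bool" where
  "pm1_observable n A \<longleftrightarrow>
     A \<in> carrier_mat (2 ^ n) (2 ^ n) \<and> mat_adjoint A = A \<and> A * A = 1\<^sub>m (2 ^ n)"

definition chsh_operator ::
    "complex mat \<Rightarrow> complex mat \<Rightarrow> complex mat \<Rightarrow> complex mat \<Rightarrow> complex mat" where
  "chsh_operator A0 A1 B0 B1 =
     tensor_mat A0 B0 + tensor_mat A0 B1 + tensor_mat A1 B0 - tensor_mat A1 B1"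

text \<open>The expectation value \<open>\<langle>v|C|v\<rangle>\<close>. The product \<open>\<bullet>c\<close> conjugates its second argument. For Hermitian
  \<open>C\<close>, such as a CHSH operator of observables, \<open>\<langle>v|C|v\<rangle>\<close> is real, so taking the real part only converts
  the type.\<close>

definition expectation_value :: "complex mat \<Rightarrow> complex vec \<Rightarrow> real" where
  "expectation_value C v = Re ((C *\<^sub>v v) \<bullet>c v)"

definition orthonormal_family :: "nat \<Rightarrow> (nat \<Rightarrow> complex vec) \<Rightarrow> bool" where
  "orthonormal_family d a \<longleftrightarrow>
     (\<forall>i<d. a i \<in> carrier_vec d) \<and>
     (\<forall>i<d. \<forall>j<d. a i \<bullet>c a j = (if i = j then 1 else 0))"

text \<open>\<open>schmidt_squares d v l\<close> says that \<open>l\<close> lists, in decreasing order and including zeros, the squared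
  coefficients of a Schmidt decomposition of the bipartite vector \<open>v\<close> on two \<open>d\<close>-dimensional
  systems.\<close>

definition schmidt_squares :: "nat \<Rightarrow> complex vec \<Rightarrow> real list \<Rightarrow> bool" where
  "schmidt_squares d v l \<longleftrightarrow>
     length l = d \<and> sorted_wrt (\<ge>) l \<and> (\<forall>x\<in>set l. 0 \<le> x) \<and>
     (\<exists>a b. orthonormal_family d a \<and> orthonormal_family d b \<and>
        v = finsum_vec TYPE(complex) (d * d)
              (\<lambda>i. complex_of_real (sqrt (l ! i)) \<cdot>\<^sub>v tensor_vec (a i) (b i)) {..<d})"

text \<open>Every \<open>v\<close> of dimension \<open>d * d\<close> has a Schmidt decomposition, and its decreasingly sorted list of
  squared coefficients is unique, so the choice below is between equal lists.\<close>

definition squared_schmidt_coeffs :: "nat \<Rightarrow> complex vec \<Rightarrow> real list" where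
  "squared_schmidt_coeffs d v = (SOME l. schmidt_squares d v l)"

text \<open>The optimal probability of converting the pure state \<open>v\<close> of two \<open>d\<close>-dimensional systems into a
  Bell state by local operations and classical communication, given by the formula of Lo and Popescu
  in terms of the squared Schmidt coefficients (numbered from \<open>1\<close> to \<open>d\<close> in the sum).\<close>

definition distillation_prob :: "nat \<Rightarrow> complex vec \<Rightarrow> real" where
  "distillation_prob d v =
     (let l = squared_schmidt_coeffs d v
      in Min ((\<lambda>r. 2 / real r * (\<Sum>i = 3 - r..d. l ! (i - 1))) ` {1..2}))"

definition p_succ :: "nat \<Rightarrow> real \<Rightarrow> real" where
  "p_succ n p = distillation_prob (2 ^ n) (n_copies n (Psi p))"

definition V_ED :: "nat \<Rightarrow> real \<Rightarrow> real" where
  "V_ED n p = 2 * sqrt 2 * p_succ n p + 2 * (1 - p_succ n p)"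

end

theory Submission
  imports Defs
begin

text \<open>The tensor power has the Schmidt vectors \<open>h\<^sub>x\<close> (columns of the \<open>n\<close>-fold Hadamard matrix) and
  Schmidt coefficients \<open>c\<^sup>n\<^sup>-\<^sup>k s\<^sup>k\<close>, with \<open>k\<close> the number of ones of \<open>x\<close>, where \<open>p = (c + s)\<^sup>2 / 2\<close>. Sorting
  the coefficients decreasingly and grouping consecutive ones as \<open>(\<mu>\<^sub>0, \<mu>\<^sub>1), (\<mu>\<^sub>2, \<mu>\<^sub>3), \<dots>\<close> splits the
  state into two-qubit blocks. On each block Alice measures \<open>\<sigma>\<^sub>z, \<sigma>\<^sub>x\<close> and Bob \<open>\<alpha> \<sigma>\<^sub>z \<plusminus> \<beta> \<sigma>\<^sub>x\<close> with
  angles adapted to the block, which gives \<open>2 \<alpha> (\<mu>\<^sup>2 + \<mu>'\<^sup>2) + 4 \<beta> \<mu> \<mu>'\<close> for the block \<open>(\<mu>, \<mu>')\<close>.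
  For small \<open>s\<close> and optimal angles the total is about \<open>2 + 4 s\<^sup>2\<close> for \<open>n = 2\<close> and \<open>2 + 4 \<surd>2 s\<^sup>2\<close> for
  \<open>n = 3\<close>, where a block with \<open>\<mu> = \<mu>'\<close> is maximally entangled. Distillation has value at most
  \<open>2 + 4 (\<surd>2 - 1) (1 - c\<^sup>2\<^sup>n)\<close>, which is about \<open>2 + 4 (\<surd>2 - 1) n s\<^sup>2\<close> and thus smaller.
  The last bound needs only that the largest squared Schmidt coefficient
  is at least the squared overlap \<open>c\<^sup>2\<^sup>n\<close> with the product vector \<open>h\<^sub>0 \<otimes> h\<^sub>0\<close>.\<close>

section \<open>Tensor products of vectors and matrices\<close>

text \<open>Quotient and remainder by \<open>e\<close> enumerate the lexicographic index pairs. This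
  turns every sum over a tensor product index into a double sum, which then factors over the two
  systems.\<close>

lemma sum_lessThan_div_mod:
  fixes f :: "nat \<Rightarrow> nat \<Rightarrow> 'a::comm_monoid_add"
  shows "(\<Sum>k<d * e. f (k div e) (k mod e)) = (\<Sum>i<d. \<Sum>j<e. f i j)"
proof -
  have "(\<Sum>k<d * e. f (k div e) (k mod e)) =
      (\<Sum>i<d. \<Sum>k\<in>{i * e..<i * e + e}. f (k div e) (k mod e))"
    by (rule sum.nat_group[symmetric])
  also have "\<dots> = (\<Sum>i<d. \<Sum>j<e. f i j)"
  proof (rule sum.cong[OF refl])
    fix i
    have "(\<Sum>k\<in>{i * e..<i * e + e}. f (k div e) (k mod e)) =
        (\<Sum>j<e. f ((i * e + j) div e) ((i * e + j) mod e))"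
      by (subst sum.atLeastLessThan_shift_0) (simp add: lessThan_atLeast0 add.commute)
    also have "\<dots> = (\<Sum>j<e. f i j)"
      by (rule sum.cong) auto
    finally show "(\<Sum>k\<in>{i * e..<i * e + e}. f (k div e) (k mod e)) = (\<Sum>j<e. f i j)" .
  qed
  finally show ?thesis .
qed

lemma cscalar_prod_sum:
  fixes v w :: "complex vec"
  assumes "w \<in> carrier_vec d"
  shows "v \<bullet>c w = (\<Sum>i<d. v $ i * cnj (w $ i))"
  using assms by (auto simp: scalar_prod_def lessThan_atLeast0 intro!: sum.cong)

lemma dim_tensor_vec [simp]: "dim_vec (tensor_vec u v) = dim_vec u * dim_vec v"
  by (simp add: tensor_vec_def)

lemma tensor_vec_closed:
  assumes "u \<in> carrier_vec d" "v \<in> carrier_vec e"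
  shows "tensor_vec u v \<in> carrier_vec (d * e)"
  using assms by (intro carrier_vecI) auto

lemma tensor_vec_index:
  assumes "k < dim_vec u * dim_vec v"
  shows "tensor_vec u v $ k = u $ (k div dim_vec v) * v $ (k mod dim_vec v)"
  using assms by (simp add: tensor_vec_def)

lemma tensor_mat_closed:
  assumes "A \<in> carrier_mat d d" "B \<in> carrier_mat e e"
  shows "tensor_mat A B \<in> carrier_mat (d * e) (d * e)"
  using assms by (intro carrier_matI) (auto simp: tensor_mat_def)

lemma cscalar_prod_tensor_vec:
  assumes u: "u \<in> carrier_vec d" and x: "x \<in> carrier_vec d"
    and v: "v \<in> carrier_vec e" and y: "y \<in> carrier_vec e"
  shows "tensor_vec u v \<bullet>c tensor_vec x y = (u \<bullet>c x) * (v \<bullet>c y)"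
proof -
  have "tensor_vec u v \<bullet>c tensor_vec x y =
      (\<Sum>k<d * e. (u $ (k div e) * v $ (k mod e)) * cnj (x $ (k div e) * y $ (k mod e)))"
    using assms by (subst cscalar_prod_sum[OF tensor_vec_closed])
      (auto intro!: sum.cong simp: tensor_vec_index)
  also have "\<dots> = (\<Sum>i<d. \<Sum>j<e. (u $ i * v $ j) * cnj (x $ i * y $ j))"
    by (rule sum_lessThan_div_mod)
  also have "\<dots> = (u \<bullet>c x) * (v \<bullet>c y)"
    by (simp add: cscalar_prod_sum[OF x] cscalar_prod_sum[OF y] sum_product algebra_simps)
  finally show ?thesis .
qed

lemma mult_mat_vec_sum:
  assumes "A \<in> carrier_mat d e" "v \<in> carrier_vec e" "i < d"
  shows "(A *\<^sub>v v) $ i = (\<Sum>j<e. A $$ (i, j) * v $ j)"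
  using assms by (auto simp: scalar_prod_def lessThan_atLeast0 intro!: sum.cong)

lemma tensor_mat_mult_tensor_vec:
  assumes A: "A \<in> carrier_mat d d" and B: "B \<in> carrier_mat e e"
    and u: "u \<in> carrier_vec d" and v: "v \<in> carrier_vec e"
  shows "tensor_mat A B *\<^sub>v tensor_vec u v = tensor_vec (A *\<^sub>v u) (B *\<^sub>v v)"
proof (rule eq_vecI)
  fix k assume "k < dim_vec (tensor_vec (A *\<^sub>v u) (B *\<^sub>v v))"
  hence k: "k < d * e" using A B by auto
  hence e0: "e > 0" by (cases e) auto
  have kd: "k div e < d" using k by (simp add: less_mult_imp_div_less)
  have km: "k mod e < e" using e0 by simp
  have "(tensor_mat A B *\<^sub>v tensor_vec u v) $ k =
     (\<Sum>l<d * e. tensor_mat A B $$ (k, l) * tensor_vec u v $ l)"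
    by (rule mult_mat_vec_sum[OF tensor_mat_closed[OF A B] tensor_vec_closed[OF u v] k])
  also have "\<dots> = (\<Sum>l<d * e. (A $$ (k div e, l div e) * B $$ (k mod e, l mod e))
      * (u $ (l div e) * v $ (l mod e)))"
    using assms k by (intro sum.cong) (auto simp: tensor_vec_index tensor_mat_def)
  also have "\<dots> = (\<Sum>i<d. \<Sum>j<e. (A $$ (k div e, i) * B $$ (k mod e, j)) * (u $ i * v $ j))"
    by (rule sum_lessThan_div_mod)
  also have "\<dots> = (A *\<^sub>v u) $ (k div e) * (B *\<^sub>v v) $ (k mod e)"
    by (simp add: mult_mat_vec_sum[OF A u kd] mult_mat_vec_sum[OF B v km] sum_product algebra_simps)
  also have "\<dots> = tensor_vec (A *\<^sub>v u) (B *\<^sub>v v) $ k"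
    using A B k by (subst tensor_vec_index) auto
  finally show "(tensor_mat A B *\<^sub>v tensor_vec u v) $ k = tensor_vec (A *\<^sub>v u) (B *\<^sub>v v) $ k" .
qed (use assms in \<open>auto simp: tensor_mat_def\<close>)

section \<open>Linear combinations of vectors\<close>

text \<open>This has the shape of the sum in \<open>schmidt_squares\<close>, but with arbitrary
  coefficients, so that Schmidt decompositions fold into it directly.\<close>

definition lincomb_vec :: "nat \<Rightarrow> nat \<Rightarrow> (nat \<Rightarrow> complex) \<Rightarrow> (nat \<Rightarrow> complex vec) \<Rightarrow> complex vec" where
  "lincomb_vec N d c w = finsum_vec TYPE(complex) N (\<lambda>i. c i \<cdot>\<^sub>v w i) {..<d}"

context
  fixes N d :: nat and w :: "nat \<Rightarrow> complex vec"
  assumes w: "\<And>i. i < d \<Longrightarrow> w i \<in> carrier_vec N"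
begin

lemma lincomb_vec_closed: "lincomb_vec N d c w \<in> carrier_vec N"
  unfolding lincomb_vec_def by (rule finsum_vec_closed) (use w in auto)

lemma lincomb_vec_index:
  assumes "k < N"
  shows "lincomb_vec N d c w $ k = (\<Sum>i<d. c i * w i $ k)"
proof -
  have "(c i \<cdot>\<^sub>v w i) $ k = c i * w i $ k" if "i < d" for i
    using w[OF that] assms by simp
  thus ?thesis
    unfolding lincomb_vec_def using assms w by (subst index_finsum_vec) auto
qed

lemma lincomb_vec_eqI:
  assumes "v \<in> carrier_vec N" "\<And>k. k < N \<Longrightarrow> v $ k = (\<Sum>i<d. c i * w i $ k)"
  shows "v = lincomb_vec N d c w"
  using assms carrier_vecD[OF lincomb_vec_closed] by (intro eq_vecI) (auto simp: lincomb_vec_index)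

lemma cscalar_prod_lincomb_left:
  assumes "u \<in> carrier_vec N"
  shows "lincomb_vec N d c w \<bullet>c u = (\<Sum>i<d. c i * (w i \<bullet>c u))"
  by (simp add: cscalar_prod_sum[OF assms] lincomb_vec_index sum_distrib_left sum_distrib_right
      mult.assoc sum.swap[of _ "{..<d}"])

lemma cscalar_prod_lincomb_right:
  assumes "u \<in> carrier_vec N"
  shows "u \<bullet>c lincomb_vec N d c w = (\<Sum>i<d. cnj (c i) * (u \<bullet>c w i))"
proof -
  have "(\<Sum>i<d. cnj (c i) * (u \<bullet>c w i)) = (\<Sum>i<d. \<Sum>k<N. cnj (c i) * (u $ k * cnj (w i $ k)))"
    by (intro sum.cong refl) (auto simp: cscalar_prod_sum[OF w] sum_distrib_left)
  also have "\<dots> = u \<bullet>c lincomb_vec N d c w"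
    by (simp add: cscalar_prod_sum[OF lincomb_vec_closed] lincomb_vec_index sum_distrib_left
        sum.swap[of _ "{..<d}"] algebra_simps)
  finally show ?thesis by simp
qed

lemma mult_mat_vec_lincomb:
  assumes A: "A \<in> carrier_mat N N"
  shows "A *\<^sub>v lincomb_vec N d c w = lincomb_vec N d c (\<lambda>i. A *\<^sub>v w i)"
proof (rule eq_vecI)
  have c: "lincomb_vec N d c (\<lambda>i. A *\<^sub>v w i) \<in> carrier_vec N"
    unfolding lincomb_vec_def by (rule finsum_vec_closed) (use w A in auto)
  show "dim_vec (A *\<^sub>v lincomb_vec N d c w) = dim_vec (lincomb_vec N d c (\<lambda>i. A *\<^sub>v w i))"
    using A c by auto
  fix k assume "k < dim_vec (lincomb_vec N d c (\<lambda>i. A *\<^sub>v w i))"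
  hence k: "k < N" using c by simp
  have "lincomb_vec N d c (\<lambda>i. A *\<^sub>v w i) $ k = (\<Sum>i<d. c i * (A *\<^sub>v w i) $ k)"
  proof -
    have "(c i \<cdot>\<^sub>v (A *\<^sub>v w i)) $ k = c i * (A *\<^sub>v w i) $ k" for i
      using k A by simp
    thus ?thesis
      unfolding lincomb_vec_def using k w A by (subst index_finsum_vec) auto
  qed
  also have "\<dots> = (\<Sum>i<d. c i * (\<Sum>j<N. A $$ (k, j) * w i $ j))"
    by (intro sum.cong refl) (subst mult_mat_vec_sum[OF A w k], auto)
  also have "\<dots> = (\<Sum>j<N. A $$ (k, j) * lincomb_vec N d c w $ j)"
    by (simp add: lincomb_vec_index sum_distrib_left sum.swap[of _ "{..<d}"] algebra_simps)
  also have "\<dots> = (A *\<^sub>v lincomb_vec N d c w) $ k"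
    by (rule mult_mat_vec_sum[symmetric, OF A lincomb_vec_closed k])
  finally show "(A *\<^sub>v lincomb_vec N d c w) $ k = lincomb_vec N d c (\<lambda>i. A *\<^sub>v w i) $ k" by simp
qed

end

section \<open>Observables with prescribed matrix elements\<close>

lemma orthonormal_family_closed:
  "orthonormal_family d a \<Longrightarrow> i < d \<Longrightarrow> a i \<in> carrier_vec d"
  by (simp add: orthonormal_family_def)

lemma orthonormal_family_cscalar_prod:
  "orthonormal_family d a \<Longrightarrow> i < d \<Longrightarrow> j < d \<Longrightarrow> a i \<bullet>c a j = (if i = j then 1 else 0)"
  by (simp add: orthonormal_family_def)

lemma sum_pairs: "(\<Sum>i<2 * m. f i) = (\<Sum>j<m. f (2 * j) + f (2 * j + 1))" for f :: "nat \<Rightarrow> 'a::comm_monoid_add"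
  by (induction m) (simp_all add: add.assoc)

lemma sum_single_pair:
  fixes f :: "nat \<Rightarrow> 'a::comm_monoid_add"
  assumes "j < m" "\<And>k. k < 2 * m \<Longrightarrow> k div 2 \<noteq> j \<Longrightarrow> f k = 0"
  shows "(\<Sum>k<2 * m. f k) = f (2 * j) + f (2 * j + 1)"
proof -
  have "(\<Sum>k<2 * m. f k) = (\<Sum>k\<in>{2 * j, 2 * j + 1}. f k)"
  proof (intro sum.mono_neutral_right ballI)
    fix k assume "k \<in> {..<2 * m} - {2 * j, 2 * j + 1}"
    hence "k < 2 * m" "k div 2 \<noteq> j" by auto
    thus "f k = 0" by (rule assms(2))
  qed (use assms(1) in auto)
  thus ?thesis by simp
qed

lemma mat_adjoint_index:
  assumes "A \<in> carrier_mat d d" "i < d" "j < d"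
  shows "mat_adjoint A $$ (i, j) = cnj (A $$ (j, i))"
  using assms by (simp add: mat_adjoint_def mat_of_rows_def)

lemma times_mat_sum:
  assumes "A \<in> carrier_mat d e" "B \<in> carrier_mat e f" "i < d" "j < f"
  shows "(A * B) $$ (i, j) = (\<Sum>k<e. A $$ (i, k) * B $$ (k, j))"
  using assms by (auto simp: scalar_prod_def lessThan_atLeast0 intro!: sum.cong)

text \<open>Conjugate \<open>D\<close> by the unitary \<open>U\<close> whose columns are the
  \<open>a i\<close>; this preserves being Hermitian and squaring to the identity. Observables can
  therefore be designed in the Schmidt basis.\<close>

lemma observable_with_matrix_elements:
  assumes a: "orthonormal_family (2 ^ n) a"
    and D: "pm1_observable n D"
  obtains A where "pm1_observable n A"
    and "\<And>i k. i < 2 ^ n \<Longrightarrow> k < 2 ^ n \<Longrightarrow> (A *\<^sub>v a i) \<bullet>c a k = D $$ (k, i)"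
proof -
  define d :: nat where "d = 2 ^ n"
  define U where "U = mat d d (\<lambda>(r, i). a i $ r)"
  define V where "V = mat d d (\<lambda>(i, s). cnj (a i $ s))"
  define A where "A = U * D * V"
  have [simp]: "U \<in> carrier_mat d d" "V \<in> carrier_mat d d"
    by (auto simp: U_def V_def)
  have [simp]: "D \<in> carrier_mat d d" and DD: "D * D = 1\<^sub>m d"
    and Dh: "mat_adjoint D = D"
    using D by (auto simp: pm1_observable_def d_def)
  have [simp]: "A \<in> carrier_mat d d"
    unfolding A_def by (intro mult_carrier_mat[of _ d d]) simp_all
  note ac = orthonormal_family_closed[OF a, folded d_def]
  note ao = orthonormal_family_cscalar_prod[OF a, folded d_def]
  have Va: "V *\<^sub>v a i = unit_vec d i" if i: "i < d" for i
  proof (rule eq_vecI)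
    fix k assume "k < dim_vec (unit_vec d i :: complex vec)"
    hence k: "k < d" by simp
    have "(V *\<^sub>v a i) $ k = (\<Sum>j<d. V $$ (k, j) * a i $ j)"
      by (rule mult_mat_vec_sum) (use i k ac in auto)
    also have "\<dots> = a i \<bullet>c a k"
      using k by (simp add: V_def cscalar_prod_sum[OF ac[OF k]] mult.commute)
    also have "\<dots> = unit_vec d i $ k" using i k ao by simp
    finally show "(V *\<^sub>v a i) $ k = unit_vec d i $ k" .
  qed (simp add: V_def)
  have VU: "V * U = 1\<^sub>m d"
  proof (rule eq_matI)
    fix i j assume "i < dim_row (1\<^sub>m d :: complex mat)" "j < dim_col (1\<^sub>m d :: complex mat)"
    hence i: "i < d" and j: "j < d" by auto
    have "(V * U) $$ (i, j) = (\<Sum>k<d. V $$ (i, k) * U $$ (k, j))"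
      by (rule times_mat_sum) (use i j in auto)
    also have "\<dots> = a j \<bullet>c a i"
      using i j by (simp add: U_def V_def cscalar_prod_sum[OF ac[OF i]] mult.commute)
    also have "\<dots> = 1\<^sub>m d $$ (i, j)" using i j ao by simp
    finally show "(V * U) $$ (i, j) = 1\<^sub>m d $$ (i, j)" .
  qed (auto simp: U_def V_def)
  \<comment> \<open>\<open>V\<close> is the adjoint of \<open>U\<close>, so \<open>VU\<close> is
    orthonormality of the family; for square matrices the left inverse is also a right inverse,
    which is completeness.\<close>
  have UV: "U * V = 1\<^sub>m d" by (rule mat_mult_left_right_inverse[OF _ _ VU]) auto
  note closed = mult_carrier_mat[of _ d d _ d] and assoc = assoc_mult_mat[of _ d d _ d _ d]
  \<comment> \<open>The inner \<open>V * U\<close> cancels, then \<open>D * D\<close>, then the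
    outer \<open>U * V\<close>.\<close>
  have "A * A = U * (D * ((V * U) * (D * V)))"
    unfolding A_def by (simp add: assoc closed left_mult_one_mat[of _ d d])
  also have "\<dots> = U * ((D * D) * V)"
    unfolding VU by (simp add: assoc closed left_mult_one_mat[of _ d d])
  also have "\<dots> = 1\<^sub>m d" by (simp add: DD UV left_mult_one_mat[of _ d d])
  finally have AA: "A * A = 1\<^sub>m d" .
  \<comment> \<open>With the entries written out, Hermiticity of \<open>A\<close> follows from that
    of \<open>D\<close> by exchanging the two summations.\<close>
  have Aidx: "A $$ (r, s) = (\<Sum>i<d. \<Sum>k<d. a k $ r * D $$ (k, i) * cnj (a i $ s))" if "r < d" "s < d" for r s
  proof -
    have "A $$ (r, s) = (\<Sum>i<d. (U * D) $$ (r, i) * V $$ (i, s))"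
      unfolding A_def by (rule times_mat_sum) (use that in \<open>auto intro: closed\<close>)
    also have "\<dots> = (\<Sum>i<d. (\<Sum>k<d. U $$ (r, k) * D $$ (k, i)) * V $$ (i, s))"
      by (intro sum.cong refl, subst times_mat_sum[where d = d and e = d and f = d]) (use that in auto)
    finally show ?thesis using that by (simp add: U_def V_def sum_distrib_right)
  qed
  have Dc: "cnj (D $$ (i, k)) = D $$ (k, i)" if "i < d" "k < d" for i k
    using mat_adjoint_index[of D d k i] that by (simp add: Dh)
  have "mat_adjoint A = A"
  proof (rule eq_matI)
    fix r s assume "r < dim_row A" "s < dim_col A"
    hence rs: "r < d" "s < d" using carrier_matD[OF \<open>A \<in> carrier_mat d d\<close>] by simp_all
    have "mat_adjoint A $$ (r, s) = cnj (A $$ (s, r))"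
      by (rule mat_adjoint_index) (use rs in auto)
    also have "\<dots> = (\<Sum>i<d. \<Sum>k<d. cnj (a k $ s) * D $$ (i, k) * a i $ r)"
      using rs by (simp add: Aidx Dc)
    also have "\<dots> = A $$ (r, s)"
      using rs by (subst sum.swap) (simp add: Aidx algebra_simps)
    finally show "mat_adjoint A $$ (r, s) = A $$ (r, s)" .
  qed (use carrier_matD[OF \<open>A \<in> carrier_mat d d\<close>] in \<open>simp_all add: mat_adjoint_def\<close>)
  hence "pm1_observable n A" using AA by (simp add: pm1_observable_def flip: d_def)
  moreover have "(A *\<^sub>v a i) \<bullet>c a k = D $$ (k, i)" if i: "i < 2 ^ n" and k: "k < 2 ^ n" for i k
  proof -
    have i: "i < d" and k: "k < d" using i k by (auto simp: d_def)
    \<comment> \<open>\<open>V\<close> sends \<open>a i\<close> to the unit vector \<open>i\<close>,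
      \<open>D\<close> picks its column \<open>i\<close>, and \<open>U\<close> reads that column as
      coefficients with respect to \<open>a\<close>.\<close>
    have "A *\<^sub>v a i = (U * D) *\<^sub>v (V *\<^sub>v a i)"
      unfolding A_def by (rule assoc_mult_mat_vec[of _ d d _ d]) (use ac i in \<open>auto intro: closed\<close>)
    also have "\<dots> = U *\<^sub>v (D *\<^sub>v unit_vec d i)"
      unfolding Va[OF i] by (rule assoc_mult_mat_vec[of _ d d _ d]) auto
    also have "D *\<^sub>v unit_vec d i = vec d (\<lambda>j. D $$ (j, i))"
      using i by (intro eq_vecI) (auto simp: carrier_matD[OF \<open>D \<in> carrier_mat d d\<close>])
    also have "U *\<^sub>v \<dots> = lincomb_vec d d (\<lambda>j. D $$ (j, i)) a"
    proof (rule eq_vecI)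
      show "dim_vec (U *\<^sub>v vec d (\<lambda>j. D $$ (j, i))) = dim_vec (lincomb_vec d d (\<lambda>j. D $$ (j, i)) a)"
        using carrier_vecD[OF lincomb_vec_closed[OF ac]] by (simp add: U_def)
      fix r assume "r < dim_vec (lincomb_vec d d (\<lambda>j. D $$ (j, i)) a)"
      hence r: "r < d" using carrier_vecD[OF lincomb_vec_closed[OF ac]] by simp
      have "(U *\<^sub>v vec d (\<lambda>j. D $$ (j, i))) $ r = (\<Sum>j<d. U $$ (r, j) * vec d (\<lambda>j. D $$ (j, i)) $ j)"
        by (rule mult_mat_vec_sum) (use r in auto)
      also have "\<dots> = lincomb_vec d d (\<lambda>j. D $$ (j, i)) a $ r"
        using r by (simp add: lincomb_vec_index[OF ac] U_def mult.commute)
      finally show "(U *\<^sub>v vec d (\<lambda>j. D $$ (j, i))) $ r = lincomb_vec d d (\<lambda>j. D $$ (j, i)) a $ r" .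
    qed
    finally have "(A *\<^sub>v a i) \<bullet>c a k = (\<Sum>j<d. D $$ (j, i) * (a j \<bullet>c a k))"
      by (simp add: cscalar_prod_lincomb_left[OF ac ac[OF k]])
    also have "\<dots> = D $$ (k, i)" using k by (simp add: ao if_distrib cong: if_cong)
    finally show ?thesis .
  qed
  ultimately show thesis by (rule that)
qed

section \<open>CHSH values of states in Schmidt form\<close>

text \<open>Expand both copies of \<open>v\<close>: on product vectors the operator acts factor by
  factor, and the real coefficients are unaffected by conjugation.\<close>

lemma expectation_tensor_mat:
  assumes a: "\<And>i. i < d \<Longrightarrow> a i \<in> carrier_vec d" and b: "\<And>i. i < d \<Longrightarrow> b i \<in> carrier_vec d"
    and A: "A \<in> carrier_mat d d" and B: "B \<in> carrier_mat d d"
    and v: "v = lincomb_vec (d * d) d (\<lambda>i. complex_of_real (\<mu> i)) (\<lambda>i. tensor_vec (a i) (b i))"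
  shows "(tensor_mat A B *\<^sub>v v) \<bullet>c v =
    (\<Sum>i<d. \<Sum>k<d. complex_of_real (\<mu> i * \<mu> k) * (((A *\<^sub>v a i) \<bullet>c a k) * ((B *\<^sub>v b i) \<bullet>c b k)))"
proof -
  let ?t = "\<lambda>i. tensor_vec (a i) (b i)"
  have t: "?t i \<in> carrier_vec (d * d)" if "i < d" for i
    using a b that by (intro tensor_vec_closed) auto
  have At: "tensor_mat A B *\<^sub>v ?t i \<in> carrier_vec (d * d)" if "i < d" for i
    using tensor_mat_closed[OF A B] by (rule mult_mat_vec_carrier) (use t that in auto)
  have vc: "v \<in> carrier_vec (d * d)" unfolding v by (rule lincomb_vec_closed[OF t])
  have "tensor_mat A B *\<^sub>v v = lincomb_vec (d * d) d \<mu> (\<lambda>i. tensor_mat A B *\<^sub>v ?t i)"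
    unfolding v by (rule mult_mat_vec_lincomb[OF t tensor_mat_closed[OF A B]])
  hence "(tensor_mat A B *\<^sub>v v) \<bullet>c v = (\<Sum>i<d. \<mu> i * ((tensor_mat A B *\<^sub>v ?t i) \<bullet>c v))"
    using cscalar_prod_lincomb_left[OF At vc] by simp
  also have "\<dots> = (\<Sum>i<d. \<mu> i * (\<Sum>k<d. \<mu> k * ((tensor_mat A B *\<^sub>v ?t i) \<bullet>c ?t k)))"
    unfolding v by (intro sum.cong refl) (subst cscalar_prod_lincomb_right[OF t At], auto)
  also have "\<dots> = (\<Sum>i<d. \<Sum>k<d. complex_of_real (\<mu> i * \<mu> k) * (((A *\<^sub>v a i) \<bullet>c a k) * ((B *\<^sub>v b i) \<bullet>c b k)))"
    unfolding sum_distrib_left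
  proof (intro sum.cong refl)
    fix i k assume "i \<in> {..<d}" "k \<in> {..<d}"
    hence "i < d" "k < d" by auto
    hence "(tensor_mat A B *\<^sub>v ?t i) \<bullet>c ?t k = ((A *\<^sub>v a i) \<bullet>c a k) * ((B *\<^sub>v b i) \<bullet>c b k)"
      using a b A B by (subst tensor_mat_mult_tensor_vec[OF A B])
        (auto intro!: cscalar_prod_tensor_vec mult_mat_vec_carrier)
    thus "\<mu> i * (\<mu> k * ((tensor_mat A B *\<^sub>v ?t i) \<bullet>c ?t k))
      = complex_of_real (\<mu> i * \<mu> k) * (((A *\<^sub>v a i) \<bullet>c a k) * ((B *\<^sub>v b i) \<bullet>c b k))" by simp
  qed
  finally show ?thesis .
qed

lemma expectation_chsh_operator:
  assumes "A0 \<in> carrier_mat d d" "A1 \<in> carrier_mat d d" "B0 \<in> carrier_mat d d" "B1 \<in> carrier_mat d d"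
    and v: "v \<in> carrier_vec (d * d)"
  shows "expectation_value (chsh_operator A0 A1 B0 B1) v =
    Re ((tensor_mat A0 B0 *\<^sub>v v) \<bullet>c v + (tensor_mat A0 B1 *\<^sub>v v) \<bullet>c v
      + (tensor_mat A1 B0 *\<^sub>v v) \<bullet>c v - (tensor_mat A1 B1 *\<^sub>v v) \<bullet>c v)"
proof -
  let ?N = "d * d"
  note c = tensor_mat_closed[OF assms(1,3)] tensor_mat_closed[OF assms(1,4)]
    tensor_mat_closed[OF assms(2,3)] tensor_mat_closed[OF assms(2,4)]
  have cv: "conjugate v \<in> carrier_vec ?N" using v by simp
  show ?thesis
    unfolding expectation_value_def chsh_operator_def
    using c v cv
    by (simp add: minus_mult_distrib_mat_vec[of _ ?N ?N] add_mult_distrib_mat_vec[of _ ?N ?N]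
        minus_scalar_prod_distrib[of _ ?N] add_scalar_prod_distrib[of _ ?N])
qed

text \<open>The block sum of the reflections \<open>\<alpha> j \<sigma>\<^sub>z + \<beta> j \<sigma>\<^sub>x\<close> on the coordinates \<open>2 j\<close> and \<open>2 j + 1\<close>.\<close>

definition pair_entry :: "(nat \<Rightarrow> real) \<Rightarrow> (nat \<Rightarrow> real) \<Rightarrow> nat \<Rightarrow> nat \<Rightarrow> real" where
  "pair_entry \<alpha> \<beta> i j =
     (if i div 2 \<noteq> j div 2 then 0
      else if i \<noteq> j then \<beta> (i div 2)
      else if even i then \<alpha> (i div 2) else - \<alpha> (i div 2))"

definition pair_mat :: "nat \<Rightarrow> (nat \<Rightarrow> real) \<Rightarrow> (nat \<Rightarrow> real) \<Rightarrow> complex mat" where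
  "pair_mat n \<alpha> \<beta> = mat (2 ^ n) (2 ^ n) (\<lambda>(i, j). complex_of_real (pair_entry \<alpha> \<beta> i j))"

lemma pair_entry_sym: "pair_entry \<alpha> \<beta> i j = pair_entry \<alpha> \<beta> j i"
  by (auto simp: pair_entry_def)

lemma pm1_observable_pair_mat:
  assumes m: "2 ^ n = 2 * m" and unit: "\<And>j. j < m \<Longrightarrow> (\<alpha> j)\<^sup>2 + (\<beta> j)\<^sup>2 = 1"
  shows "pm1_observable n (pair_mat n \<alpha> \<beta>)"
proof -
  let ?D = "pair_mat n \<alpha> \<beta>" and ?e = "pair_entry \<alpha> \<beta>"
  have D: "?D \<in> carrier_mat (2 ^ n) (2 ^ n)" by (simp add: pair_mat_def)
  have "mat_adjoint ?D = ?D"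
  proof (rule eq_matI)
    fix i j assume "i < dim_row ?D" "j < dim_col ?D"
    hence ij: "i < 2 ^ n" "j < 2 ^ n" using D by auto
    show "mat_adjoint ?D $$ (i, j) = ?D $$ (i, j)"
      unfolding mat_adjoint_index[OF D ij] using ij by (simp add: pair_mat_def pair_entry_sym)
  qed (use D in \<open>auto simp: mat_adjoint_def\<close>)
  moreover have "?D * ?D = 1\<^sub>m (2 ^ n)"
  proof (rule eq_matI)
    fix i j assume "i < dim_row (1\<^sub>m (2 ^ n) :: complex mat)" "j < dim_col (1\<^sub>m (2 ^ n) :: complex mat)"
    hence ij: "i < 2 ^ n" "j < 2 ^ n" by auto
    define q where "q = i div 2"
    have q: "q < m" using ij m by (auto simp: q_def)
    \<comment> \<open>Only the two indices in the block of \<open>i\<close> contribute; within that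
      block the 2 by 2 reflection squares to \<alpha>^2 + \<beta>^2 = 1.\<close>
    have "(\<Sum>k<2 ^ n. ?e i k * ?e k j) = ?e i (2 * q) * ?e (2 * q) j + ?e i (2 * q + 1) * ?e (2 * q + 1) j"
      unfolding m by (rule sum_single_pair[OF q]) (auto simp: pair_entry_def q_def)
    also have "\<dots> = (if i = j then 1 else 0)"
    proof (cases "j div 2 = q")
      case False
      thus ?thesis by (auto simp: pair_entry_def q_def)
    next
      case True
      have "i = 2 * q \<or> i = 2 * q + 1" "j = 2 * q \<or> j = 2 * q + 1"
        using True q_def by presburger+
      thus ?thesis using unit[OF q] by (auto simp: pair_entry_def power2_eq_square algebra_simps)
    qed
    finally have *: "(\<Sum>k<2 ^ n. ?e i k * ?e k j) = (if i = j then 1 else 0)" .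
    have "(?D * ?D) $$ (i, j) = (\<Sum>k<2 ^ n. ?D $$ (i, k) * ?D $$ (k, j))"
      by (rule times_mat_sum[OF D D ij])
    also have "\<dots> = complex_of_real (\<Sum>k<2 ^ n. ?e i k * ?e k j)"
      using ij by (simp add: pair_mat_def)
    finally show "(?D * ?D) $$ (i, j) = 1\<^sub>m (2 ^ n) $$ (i, j)" using * ij by simp
  qed (use D in auto)
  ultimately show ?thesis using D by (simp add: pm1_observable_def)
qed

text \<open>The CHSH operator is \<open>A0\<close> tensor \<open>B0 + B1\<close> plus
  \<open>A1\<close> tensor \<open>B0 - B1\<close>. On each block \<open>B0 + B1\<close> is 2
  \<alpha> \<sigma>_z and \<open>B0 - B1\<close> is 2 \<beta> \<sigma>_x, so the diagonal matrix
  elements give the squares and the two off-diagonal ones give the cross term twice.\<close>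

lemma chsh_value_of_paired_schmidt_vectors:
  fixes \<mu> :: "nat \<Rightarrow> real"
  assumes m: "2 ^ n = 2 * m" and unit: "\<And>j. j < m \<Longrightarrow> (\<alpha> j)\<^sup>2 + (\<beta> j)\<^sup>2 = 1"
    and a: "orthonormal_family (2 ^ n) a" and b: "orthonormal_family (2 ^ n) b"
    and v: "v = lincomb_vec (2 ^ n * 2 ^ n) (2 ^ n) (\<lambda>i. complex_of_real (\<mu> i)) (\<lambda>i. tensor_vec (a i) (b i))"
  obtains A0 A1 B0 B1 where
    "pm1_observable n A0" "pm1_observable n A1" "pm1_observable n B0" "pm1_observable n B1"
    "expectation_value (chsh_operator A0 A1 B0 B1) v =
       (\<Sum>j<m. 2 * \<alpha> j * ((\<mu> (2 * j))\<^sup>2 + (\<mu> (2 * j + 1))\<^sup>2) + 4 * \<beta> j * (\<mu> (2 * j) * \<mu> (2 * j + 1)))"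
proof -
  let ?Z = "pair_entry (\<lambda>_. 1) (\<lambda>_. 0)" and ?X = "pair_entry (\<lambda>_. 0) (\<lambda>_. 1)"
  let ?P = "pair_entry \<alpha> \<beta>" and ?M = "pair_entry \<alpha> (\<lambda>j. - \<beta> j)"
  let ?d = "2 ^ n :: nat"
  note ex = observable_with_matrix_elements pm1_observable_pair_mat[OF m]
  obtain A0 where A0: "pm1_observable n A0"
    and eA0: "\<And>i k. i < ?d \<Longrightarrow> k < ?d \<Longrightarrow> (A0 *\<^sub>v a i) \<bullet>c a k = pair_mat n (\<lambda>_. 1) (\<lambda>_. 0) $$ (k, i)"
    by (rule ex(1)[OF a ex(2)[of "\<lambda>_. 1" "\<lambda>_. 0"]]) auto
  obtain A1 where A1: "pm1_observable n A1"
    and eA1: "\<And>i k. i < ?d \<Longrightarrow> k < ?d \<Longrightarrow> (A1 *\<^sub>v a i) \<bullet>c a k = pair_mat n (\<lambda>_. 0) (\<lambda>_. 1) $$ (k, i)"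
    by (rule ex(1)[OF a ex(2)[of "\<lambda>_. 0" "\<lambda>_. 1"]]) auto
  obtain B0 where B0: "pm1_observable n B0"
    and eB0: "\<And>i k. i < ?d \<Longrightarrow> k < ?d \<Longrightarrow> (B0 *\<^sub>v b i) \<bullet>c b k = pair_mat n \<alpha> \<beta> $$ (k, i)"
    by (rule ex(1)[OF b ex(2)[of \<alpha> \<beta>]]) (use unit in auto)
  obtain B1 where B1: "pm1_observable n B1"
    and eB1: "\<And>i k. i < ?d \<Longrightarrow> k < ?d \<Longrightarrow> (B1 *\<^sub>v b i) \<bullet>c b k = pair_mat n \<alpha> (\<lambda>j. - \<beta> j) $$ (k, i)"
    by (rule ex(1)[OF b ex(2)[of \<alpha> "\<lambda>j. - \<beta> j"]]) (use unit in auto)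
  note c = A0[unfolded pm1_observable_def, THEN conjunct1] A1[unfolded pm1_observable_def, THEN conjunct1]
    B0[unfolded pm1_observable_def, THEN conjunct1] B1[unfolded pm1_observable_def, THEN conjunct1]
  note ac = orthonormal_family_closed[OF a] and bc = orthonormal_family_closed[OF b]
  have vc: "v \<in> carrier_vec (?d * ?d)"
    unfolding v by (rule lincomb_vec_closed) (rule tensor_vec_closed[OF ac bc])
  note tensor = expectation_tensor_mat[OF ac bc _ _ v]
  have entries: "(tensor_mat A B *\<^sub>v v) \<bullet>c v = complex_of_real (\<Sum>i<?d. \<Sum>k<?d. \<mu> i * \<mu> k * (pair_entry f g k i * pair_entry f' g' k i))"
    if "A \<in> carrier_mat ?d ?d" "B \<in> carrier_mat ?d ?d"
      and "\<And>i k. i < ?d \<Longrightarrow> k < ?d \<Longrightarrow> (A *\<^sub>v a i) \<bullet>c a k = pair_mat n f g $$ (k, i)"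
      and "\<And>i k. i < ?d \<Longrightarrow> k < ?d \<Longrightarrow> (B *\<^sub>v b i) \<bullet>c b k = pair_mat n f' g' $$ (k, i)"
    for A B f g f' g'
    using that by (simp add: tensor pair_mat_def)
  have "expectation_value (chsh_operator A0 A1 B0 B1) v =
      (\<Sum>i<?d. \<Sum>k<?d. \<mu> i * \<mu> k * (?Z k i * ?P k i)) + (\<Sum>i<?d. \<Sum>k<?d. \<mu> i * \<mu> k * (?Z k i * ?M k i))
      + (\<Sum>i<?d. \<Sum>k<?d. \<mu> i * \<mu> k * (?X k i * ?P k i)) - (\<Sum>i<?d. \<Sum>k<?d. \<mu> i * \<mu> k * (?X k i * ?M k i))"
    by (simp only: expectation_chsh_operator[OF c vc] entries[OF c(1,3) eA0 eB0] entries[OF c(1,4) eA0 eB1]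
      entries[OF c(2,3) eA1 eB0] entries[OF c(2,4) eA1 eB1] plus_complex.sel minus_complex.sel Re_complex_of_real)
  also have "\<dots> = (\<Sum>i<?d. \<Sum>k<?d. \<mu> i * \<mu> k * (?Z k i * ?P k i + ?Z k i * ?M k i + ?X k i * ?P k i - ?X k i * ?M k i))"
    by (simp add: sum.distrib sum_subtractf algebra_simps)
  \<comment> \<open>On the diagonal the signs of the two \<sigma>_z entries cancel for both
    parities. Off the diagonal the entries \<beta> and -\<beta> of Bob's two observables are
    subtracted, which gives 2 \<beta>.\<close>
  also have "\<dots> = (\<Sum>i<?d. \<Sum>k<?d. \<mu> i * \<mu> k *
      (if k div 2 \<noteq> i div 2 then 0 else if k \<noteq> i then 2 * \<beta> (i div 2) else 2 * \<alpha> (i div 2)))"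
    by (intro sum.cong refl) (simp add: pair_entry_def)
  also have "\<dots> = (\<Sum>i<2 * m. 2 * \<alpha> (i div 2) * (\<mu> i)\<^sup>2
      + 2 * \<beta> (i div 2) * (\<mu> (2 * (i div 2)) * \<mu> (2 * (i div 2) + 1)))"
    unfolding m
  proof (rule sum.cong[OF refl])
    fix i assume "i \<in> {..<2 * m}"
    define q where "q = i div 2"
    have q: "q < m" using \<open>i \<in> _\<close> by (auto simp: q_def)
    have i: "i = 2 * q \<or> i = 2 * q + 1" unfolding q_def by presburger
    let ?f = "\<lambda>k. \<mu> i * \<mu> k * (if k div 2 \<noteq> i div 2 then 0
      else if k \<noteq> i then 2 * \<beta> (i div 2) else 2 * \<alpha> (i div 2))"
    have "(\<Sum>k<2 * m. ?f k) = ?f (2 * q) + ?f (2 * q + 1)"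
      by (rule sum_single_pair[OF q]) (simp add: q_def)
    thus "(\<Sum>k<2 * m. ?f k) = 2 * \<alpha> (i div 2) * (\<mu> i)\<^sup>2
        + 2 * \<beta> (i div 2) * (\<mu> (2 * (i div 2)) * \<mu> (2 * (i div 2) + 1))"
      using i by (auto simp: power2_eq_square)
  qed
  also have "\<dots> = (\<Sum>j<m. 2 * \<alpha> j * ((\<mu> (2 * j))\<^sup>2 + (\<mu> (2 * j + 1))\<^sup>2) + 4 * \<beta> j * (\<mu> (2 * j) * \<mu> (2 * j + 1)))"
    unfolding sum_pairs by (intro sum.cong refl) (simp add: algebra_simps)
  finally show thesis by (rule that[OF A0 A1 B0 B1])
qed

section \<open>Schmidt coefficients and the bound on distillation\<close>

lemma cscalar_prod_self_ge_0:
  assumes "x \<in> carrier_vec d"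
  shows "0 \<le> Re (x \<bullet>c (x :: complex vec))"
  by (simp add: cscalar_prod_sum[OF assms] complex_mult_cnj sum_nonneg)

lemma cnj_cscalar_prod:
  assumes "x \<in> carrier_vec d" "y \<in> carrier_vec d"
  shows "cnj (x \<bullet>c y) = (y :: complex vec) \<bullet>c x"
  by (simp add: cscalar_prod_sum[OF assms(1)] cscalar_prod_sum[OF assms(2)] mult.commute)

text \<open>For the projection \<open>r\<close> of \<open>x\<close>, the products of
  \<open>r\<close> with \<open>x\<close>, of \<open>x\<close> with \<open>r\<close> and of
  \<open>r\<close> with itself all equal the left-hand side, so expanding the nonnegative square of
  \<open>x - r\<close> gives the bound.\<close>

lemma bessel_inequality:
  assumes a: "orthonormal_family d a" and x: "x \<in> carrier_vec d"
  shows "(\<Sum>i<d. (cmod (a i \<bullet>c x))\<^sup>2) \<le> Re (x \<bullet>c x)"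
proof -
  note ac = orthonormal_family_closed[OF a] and ao = orthonormal_family_cscalar_prod[OF a]
  let ?c = "\<lambda>i. x \<bullet>c a i" and ?S = "\<Sum>i<d. (cmod (a i \<bullet>c x))\<^sup>2"
  define r where "r = lincomb_vec d d ?c a"
  have r: "r \<in> carrier_vec d" unfolding r_def by (rule lincomb_vec_closed[OF ac])
  have cs: "cnj (?c i) = a i \<bullet>c x" if "i < d" for i by (rule cnj_cscalar_prod[OF x ac[OF that]])
  have sq: "?c i * (a i \<bullet>c x) = complex_of_real ((cmod (a i \<bullet>c x))\<^sup>2)" if "i < d" for i
    using cs[OF that] by (metis complex_mod_cnj complex_norm_square)
  have rx: "r \<bullet>c x = complex_of_real ?S"
    unfolding r_def of_real_sum
    by (subst cscalar_prod_lincomb_left[OF ac x]) (auto intro!: sum.cong simp: sq)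
  have xr: "x \<bullet>c r = complex_of_real ?S"
    using cnj_cscalar_prod[OF r x] by (simp add: rx)
  have "r \<bullet>c a i = ?c i" if "i < d" for i
    unfolding r_def using that
    by (subst cscalar_prod_lincomb_left[OF ac ac[OF that]]) (simp_all add: ao if_distrib cong: if_cong)
  hence rr: "r \<bullet>c r = complex_of_real ?S"
    using sq cs unfolding of_real_sum
    by (subst (2) r_def, subst cscalar_prod_lincomb_right[OF ac r]) (auto intro!: sum.cong simp: mult.commute)
  have "(x - r) \<bullet>c (x - r) = x \<bullet>c x - r \<bullet>c x - (x \<bullet>c r - r \<bullet>c r)"
    unfolding cscalar_prod_sum[OF x] cscalar_prod_sum[OF r] using x r
    by (subst cscalar_prod_sum[of _ d]) (auto simp: algebra_simps sum.distrib sum_subtractf)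
  thus ?thesis
    using cscalar_prod_self_ge_0[of "x - r" d] x r by (simp add: rx xr rr)
qed

lemma schmidt_squares_lincomb:
  assumes "schmidt_squares d v l"
  obtains a b where "orthonormal_family d a" "orthonormal_family d b"
    "v = lincomb_vec (d * d) d (\<lambda>i. complex_of_real (sqrt (l ! i))) (\<lambda>i. tensor_vec (a i) (b i))"
  using assms unfolding schmidt_squares_def lincomb_vec_def by blast

text \<open>The product vectors are orthonormal, so the overlap of \<open>v\<close> with the one of
  index \<open>i\<close> is \<open>sqrt (l ! i)\<close>. For a unit vector the tail of
  \<open>l\<close> is thereby determined by its head.\<close>

lemma sum_schmidt_squares:
  assumes "schmidt_squares d v l"
  shows "complex_of_real (\<Sum>i<d. l ! i) = v \<bullet>c v"
proof -
  obtain a b where a: "orthonormal_family d a" and b: "orthonormal_family d b"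
    and v: "v = lincomb_vec (d * d) d (\<lambda>i. complex_of_real (sqrt (l ! i))) (\<lambda>i. tensor_vec (a i) (b i))"
    by (rule schmidt_squares_lincomb[OF assms])
  have l: "0 \<le> l ! i" if "i < d" for i using assms that by (simp add: schmidt_squares_def)
  note ac = orthonormal_family_closed[OF a] and bc = orthonormal_family_closed[OF b]
  note t = tensor_vec_closed[OF ac bc]
  have vc: "v \<in> carrier_vec (d * d)" unfolding v by (rule lincomb_vec_closed[OF t])
  have "tensor_vec (a i) (b i) \<bullet>c v = complex_of_real (sqrt (l ! i))" if "i < d" for i
    unfolding v using that
    by (subst cscalar_prod_lincomb_right[OF t t], simp_all add:
      cscalar_prod_tensor_vec[OF ac ac bc bc] orthonormal_family_cscalar_prod[OF a]
      orthonormal_family_cscalar_prod[OF b] if_distrib cong: if_cong)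
  hence "v \<bullet>c v = (\<Sum>i<d. complex_of_real (sqrt (l ! i)) * complex_of_real (sqrt (l ! i)))"
    by (subst (1) v, subst cscalar_prod_lincomb_left[OF t vc]) auto
  also have "\<dots> = (\<Sum>i<d. complex_of_real (l ! i))"
    using l by (intro sum.cong refl) (simp flip: of_real_mult)
  finally show ?thesis by simp
qed

text \<open>The overlap is the sum of \<open>sqrt (l ! i)\<close> times the overlaps on both sides.
  Replacing each coefficient by the largest, the product of overlaps by the mean of their squares,
  and applying Bessel on both sides leaves \<open>sqrt (l ! 0)\<close>. This holds for any sorted
  Schmidt list, hence also for the chosen one.\<close>

lemma product_overlap_le_schmidt:
  assumes l: "schmidt_squares d v l"
    and x: "x \<in> carrier_vec d" "x \<bullet>c x = 1" and y: "y \<in> carrier_vec d" "y \<bullet>c y = 1"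
  shows "(cmod (v \<bullet>c tensor_vec x y))\<^sup>2 \<le> l ! 0"
proof -
  obtain a b where a: "orthonormal_family d a" and b: "orthonormal_family d b"
    and v: "v = lincomb_vec (d * d) d (\<lambda>i. complex_of_real (sqrt (l ! i))) (\<lambda>i. tensor_vec (a i) (b i))"
    by (rule schmidt_squares_lincomb[OF l])
  have d: "0 < d" using x by (cases d) (auto simp: scalar_prod_def)
  have len: "length l = d" and sorted: "sorted_wrt (\<ge>) l" and nn: "\<And>i. i < d \<Longrightarrow> 0 \<le> l ! i"
    using l by (auto simp: schmidt_squares_def)
  have le: "l ! i \<le> l ! 0" if "i < d" for i
    using sorted_wrt_nth_less[OF sorted, of 0 i] that len by (cases "i = 0") auto
  note ac = orthonormal_family_closed[OF a] and bc = orthonormal_family_closed[OF b]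
  let ?p = "\<lambda>i. cmod (a i \<bullet>c x)" and ?q = "\<lambda>i. cmod (b i \<bullet>c y)"
  have "v \<bullet>c tensor_vec x y = (\<Sum>i<d. complex_of_real (sqrt (l ! i)) * ((a i \<bullet>c x) * (b i \<bullet>c y)))"
    unfolding v
    by (subst cscalar_prod_lincomb_left[OF tensor_vec_closed[OF ac bc] tensor_vec_closed[OF x(1) y(1)]])
      (auto intro!: sum.cong simp: cscalar_prod_tensor_vec[OF ac x(1) bc y(1)])
  hence "cmod (v \<bullet>c tensor_vec x y) \<le> (\<Sum>i<d. cmod (complex_of_real (sqrt (l ! i)) * ((a i \<bullet>c x) * (b i \<bullet>c y))))"
    by (simp add: norm_sum)
  also have "\<dots> \<le> (\<Sum>i<d. sqrt (l ! 0) * (((?p i)\<^sup>2 + (?q i)\<^sup>2) / 2))"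
  proof (rule sum_mono)
    fix i assume "i \<in> {..<d}"
    hence i: "i < d" by simp
    have "?p i * ?q i \<le> ((?p i)\<^sup>2 + (?q i)\<^sup>2) / 2"
      using sum_squares_bound[of "?p i" "?q i"] by simp
    hence "sqrt (l ! i) * (?p i * ?q i) \<le> sqrt (l ! 0) * (((?p i)\<^sup>2 + (?q i)\<^sup>2) / 2)"
      using le[OF i] nn[OF d] by (intro mult_mono) auto
    thus "cmod (complex_of_real (sqrt (l ! i)) * ((a i \<bullet>c x) * (b i \<bullet>c y)))
        \<le> sqrt (l ! 0) * (((?p i)\<^sup>2 + (?q i)\<^sup>2) / 2)"
      using nn[OF i] by (simp add: norm_mult)
  qed
  also have "\<dots> = sqrt (l ! 0) * (((\<Sum>i<d. (?p i)\<^sup>2) + (\<Sum>i<d. (?q i)\<^sup>2)) / 2)"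
    by (simp add: sum.distrib flip: sum_distrib_left sum_divide_distrib)
  also have "\<dots> \<le> sqrt (l ! 0) * 1"
    using bessel_inequality[OF a x(1)] bessel_inequality[OF b y(1)] x(2) y(2) nn[OF d]
    by (intro mult_left_mono) auto
  finally have "cmod (v \<bullet>c tensor_vec x y) \<le> sqrt (l ! 0)" by simp
  hence "(cmod (v \<bullet>c tensor_vec x y))\<^sup>2 \<le> (sqrt (l ! 0))\<^sup>2" by (intro power_mono) auto
  thus ?thesis using nn[OF d] by simp
qed

lemma distillation_prob_le:
  assumes ex: "schmidt_squares d v l'" and norm: "v \<bullet>c v = 1"
    and x: "x \<in> carrier_vec d" "x \<bullet>c x = 1" and y: "y \<in> carrier_vec d" "y \<bullet>c y = 1"
  shows "distillation_prob d v \<le> 2 * (1 - (cmod (v \<bullet>c tensor_vec x y))\<^sup>2)"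
proof -
  define l where "l = squared_schmidt_coeffs d v"
  \<comment> \<open>The list \<open>l'\<close> serves as a witness for the choice operator; the
    estimates below speak of the chosen list.\<close>
  have l: "schmidt_squares d v l"
    unfolding l_def squared_schmidt_coeffs_def by (rule someI[of "schmidt_squares d v", OF ex])
  have d: "0 < d" using x by (cases d) (auto simp: scalar_prod_def)
  have "complex_of_real (\<Sum>i<d. l ! i) = complex_of_real 1"
    using sum_schmidt_squares[OF l] norm by simp
  hence s: "(\<Sum>i<d. l ! i) = 1" unfolding of_real_eq_iff .
  have "(\<Sum>i = 2..d. l ! (i - 1)) = (\<Sum>i = 1..<d. l ! i)"
    by (rule sum.reindex_bij_witness[of _ Suc "\<lambda>i. i - 1"]) auto
  also have "\<dots> = 1 - l ! 0"
    using s d by (simp add: lessThan_atLeast0 sum.atLeast_Suc_lessThan)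
  finally have t: "(\<Sum>i = 2..d. l ! (i - 1)) = 1 - l ! 0" .
  \<comment> \<open>The minimum is at most its term at \<open>r = 1\<close>, twice the sum of all
    coefficients but the largest.\<close>
  have "distillation_prob d v \<le> 2 / real 1 * (\<Sum>i = 3 - 1..d. l ! (i - 1))"
    unfolding distillation_prob_def Let_def l_def[symmetric]
    by (intro Min_le image_eqI[where x = 1]) auto
  also have "\<dots> = 2 * (1 - l ! 0)" using t by simp
  also have "\<dots> \<le> 2 * (1 - (cmod (v \<bullet>c tensor_vec x y))\<^sup>2)"
    using product_overlap_le_schmidt[OF l x y] by simp
  finally show ?thesis .
qed

section \<open>Schmidt decomposition of the tensor power\<close>

text \<open>Expanding the product of binomials chooses one digit per factor, and these choices are
  the numbers below \<open>2 ^ n\<close>. The induction splits off the least significant digit, that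
  is, even from odd \<open>x\<close>.\<close>

lemma sum_bit_of_prod:
  fixes g :: "nat \<Rightarrow> nat \<Rightarrow> 'a::comm_semiring_1"
  shows "(\<Sum>x<2 ^ n. \<Prod>k<n. g k (bit_of x k)) = (\<Prod>k<n. g k 0 + g k 1)"
proof (induction n arbitrary: g)
  case (Suc n)
  have bits: "bit_of (2 * y) 0 = 0" "bit_of (2 * y + 1) 0 = 1"
    "bit_of (2 * y) (Suc k) = bit_of y k" "bit_of (2 * y + 1) (Suc k) = bit_of y k" for y k
    by (simp_all add: bit_of_def div_mult2_eq)
  have "(\<Sum>x<2 ^ Suc n. \<Prod>k<Suc n. g k (bit_of x k)) =
      (\<Sum>y<2 ^ n. g 0 0 * (\<Prod>k<n. g (Suc k) (bit_of y k)) + g 0 1 * (\<Prod>k<n. g (Suc k) (bit_of y k)))"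
    unfolding power_Suc sum_pairs prod.lessThan_Suc_shift bits ..
  also have "\<dots> = (g 0 0 + g 0 1) * (\<Prod>k<n. g (Suc k) 0 + g (Suc k) 1)"
    by (simp add: sum.distrib distrib_right Suc.IH[of "\<lambda>k. g (Suc k)"] flip: sum_distrib_left)
  also have "\<dots> = (\<Prod>k<Suc n. g k 0 + g k 1)" by (simp only: prod.lessThan_Suc_shift)
  finally show ?case .
qed simp

lemma bit_of_less_2: "bit_of i k < 2"
  by (simp add: bit_of_def)

lemma bit_of_eqI:
  assumes "x < 2 ^ n" "y < 2 ^ n" "\<And>k. k < n \<Longrightarrow> bit_of x k = bit_of y k"
  shows "x = y"
  using assms
proof (induction n arbitrary: x y)
  case (Suc n)
  have bits: "bit_of (x div 2) k = bit_of (y div 2) k" if "k < n" for k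
    using Suc.prems(3)[of "Suc k"] that by (simp add: bit_of_def div_mult2_eq)
  hence "x div 2 = y div 2" using Suc.prems(1,2) by (intro Suc.IH[OF _ _ bits]) simp_all
  moreover have "x mod 2 = y mod 2" using Suc.prems(3)[of 0] by (simp add: bit_of_def)
  ultimately show ?case by presburger
qed simp

text \<open>The entry (-1)^(b i) / sqrt 2 of the one-qubit Hadamard matrix.\<close>

definition hadamard_entry :: "nat \<Rightarrow> nat \<Rightarrow> complex" where
  "hadamard_entry b i = complex_of_real ((if b = 1 \<and> i = 1 then -1 else 1) / sqrt 2)"

definition hadamard_vec :: "nat \<Rightarrow> nat \<Rightarrow> complex vec" where
  "hadamard_vec n x = vec (2 ^ n) (\<lambda>i. \<Prod>k<n. hadamard_entry (bit_of x k) (bit_of i k))"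

definition schmidt_coeff :: "real \<Rightarrow> real \<Rightarrow> nat \<Rightarrow> nat \<Rightarrow> real" where
  "schmidt_coeff c s n x = (\<Prod>k<n. if bit_of x k = 0 then c else s)"

lemma hadamard_vec_closed: "hadamard_vec n x \<in> carrier_vec (2 ^ n)"
  by (simp add: hadamard_vec_def)

text \<open>The inner product factors over the binary digits, and a single differing digit
  contributes a factor 0.\<close>

lemma orthonormal_hadamard_vec: "orthonormal_family (2 ^ n) (hadamard_vec n)"
  unfolding orthonormal_family_def
proof (intro conjI allI impI)
  fix x y :: nat assume x: "x < 2 ^ n" and y: "y < 2 ^ n"
  let ?h = hadamard_entry
  have two: "?h a 0 * cnj (?h b 0) + ?h a 1 * cnj (?h b 1) = (if a = b then 1 else 0)"
    if "a < 2" "b < 2" for a b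
    using that by (auto simp: hadamard_entry_def less_2_cases_iff simp flip: of_real_mult of_real_add)
  have "hadamard_vec n x \<bullet>c hadamard_vec n y =
      (\<Sum>i<2 ^ n. \<Prod>k<n. ?h (bit_of x k) (bit_of i k) * cnj (?h (bit_of y k) (bit_of i k)))"
    by (subst cscalar_prod_sum[OF hadamard_vec_closed]) (simp add: hadamard_vec_def prod.distrib)
  also have "\<dots> = (\<Prod>k<n. if bit_of x k = bit_of y k then 1 else 0)"
    by (simp only: two bit_of_less_2
        sum_bit_of_prod[where g = "\<lambda>k b. ?h (bit_of x k) b * cnj (?h (bit_of y k) b)"])
  also have "\<dots> = (if x = y then 1 else 0)"
  proof (cases "x = y")
    case False
    then obtain k where "k < n" "bit_of x k \<noteq> bit_of y k" using bit_of_eqI[OF x y] by blast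
    thus ?thesis using False by (auto intro!: prod_zero)
  qed simp
  finally show "hadamard_vec n x \<bullet>c hadamard_vec n y = (if x = y then 1 else 0)" .
qed (rule hadamard_vec_closed)

text \<open>The amplitudes form the symmetric matrix with (c + s) / 2 on the diagonal and (c - s) /
  2 off it; the Hadamard columns are its eigenvectors, with eigenvalues c and s.\<close>

lemma Psi_index:
  fixes c s p :: real
  assumes "0 \<le> s" "s \<le> c" "i < 2" "j < 2"
    and cs: "c\<^sup>2 + s\<^sup>2 = 1" and p: "p = (c + s)\<^sup>2 / 2"
  shows "Psi p $ (2 * i + j) = (\<Sum>b<2. (if b = 0 then c else s) * hadamard_entry b i * hadamard_entry b j)"
proof -
  have "(c - s)\<^sup>2 + (c + s)\<^sup>2 = 2 * (c\<^sup>2 + s\<^sup>2)"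
    by (simp add: power2_eq_square algebra_simps)
  hence q: "1 - p = (c - s)\<^sup>2 / 2" using cs by (simp add: p)
  \<comment> \<open>The assumption \<open>s \<le> c\<close> makes c - s nonnegative, so the second
    root carries no absolute value.\<close>
  have sq: "sqrt p = (c + s) / sqrt 2" "sqrt (1 - p) = (c - s) / sqrt 2"
    unfolding q unfolding p using assms by (simp_all add: real_sqrt_divide)
  have half: "(c + s) / sqrt 2 * (1 / sqrt 2) = (c + s) / 2" "(c - s) / sqrt 2 * (1 / sqrt 2) = (c - s) / 2"
    by simp_all
  have ket: "ket2 x y $ (2 * i + j) = (if x = i \<and> y = j then 1 else 0)" if "x < 2" "y < 2" for x y
    using assms(3,4) that unfolding ket2_def by (subst tensor_vec_index) auto
  have "dim_vec (ket2 x y) = 4" for x y by (simp add: ket2_def)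
  moreover have "2 * i + j < 4" using assms(3,4) by simp
  ultimately have "Psi p $ (2 * i + j) =
      complex_of_real ((c + s) / sqrt 2 * (1 / sqrt 2)) * (ket2 0 0 $ (2 * i + j) + ket2 1 1 $ (2 * i + j))
      + complex_of_real ((c - s) / sqrt 2 * (1 / sqrt 2)) * (ket2 0 1 $ (2 * i + j) + ket2 1 0 $ (2 * i + j))"
    by (simp only: Psi_def bell_psi_def bell_phi_def sq of_real_mult index_add_vec index_smult_vec
        dim_vec smult_smult_assoc)
  also have "\<dots> = complex_of_real (if i = j then (c + s) / 2 else (c - s) / 2)"
    unfolding half using assms(3,4) by (auto simp: ket less_2_cases_iff)
  also have "\<dots> = (\<Sum>b<2. (if b = 0 then c else s) * hadamard_entry b i * hadamard_entry b j)"
  proof -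
    have entries: "hadamard_entry b i * hadamard_entry b j =
        complex_of_real ((if b = 1 \<and> i = 1 then -1 else 1) * (if b = 1 \<and> j = 1 then -1 else 1) / 2)" for b
      unfolding hadamard_entry_def of_real_mult[symmetric] by simp
    have "(\<Sum>b<2. (if b = 0 then c else s) * hadamard_entry b i * hadamard_entry b j) =
        complex_of_real (c / 2 + s * ((if i = 1 then -1 else 1) * (if j = 1 then -1 else 1)) / 2)"
      by (simp add: numeral_2_eq_2 mult.assoc entries)
    thus ?thesis using assms(3,4) by (auto simp: less_2_cases_iff add_divide_distrib diff_divide_distrib)
  qed
  finally show ?thesis .
qed

lemma schmidt_coeff_simps:
  "schmidt_coeff c s 0 x = 1"
  "schmidt_coeff c s (Suc n) x = (if even x then c else s) * schmidt_coeff c s n (x div 2)"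
proof -
  have "bit_of x 0 = 0 \<longleftrightarrow> even x" "bit_of x (Suc k) = bit_of (x div 2) k" for k
    by (simp_all add: bit_of_def div_mult2_eq even_iff_mod_2_eq_zero)
  thus "schmidt_coeff c s (Suc n) x = (if even x then c else s) * schmidt_coeff c s n (x div 2)"
    by (simp add: schmidt_coeff_def prod.lessThan_Suc_shift del: prod.lessThan_Suc)
qed (simp add: schmidt_coeff_def)

lemma sum_schmidt_coeff_square:
  assumes "c\<^sup>2 + s\<^sup>2 = 1"
  shows "(\<Sum>x<2 ^ n. (schmidt_coeff c s n x)\<^sup>2) = 1"
proof -
  have "(\<Sum>x<2 ^ n. (schmidt_coeff c s n x)\<^sup>2) = (\<Sum>x<2 ^ n. \<Prod>k<n. (if bit_of x k = 0 then c else s)\<^sup>2)"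
    by (simp add: schmidt_coeff_def prod_power_distrib)
  also have "\<dots> = 1"
    using assms by (simp add: sum_bit_of_prod[where g = "\<lambda>_ b. (if b = 0 then c else s)\<^sup>2"])
  finally show ?thesis .
qed

text \<open>Each copy contributes a sum over one digit by \<open>Psi_index\<close>; multiplying out
  with \<open>sum_bit_of_prod\<close> gives a sum over all \<open>x\<close>, whose terms separate
  into coefficient, Alice's entry and Bob's entry.\<close>

lemma n_copies_Psi_schmidt:
  assumes "0 \<le> s" "s \<le> c" and cs: "c\<^sup>2 + s\<^sup>2 = 1" and p: "p = (c + s)\<^sup>2 / 2"
  shows "n_copies n (Psi p) = lincomb_vec (2 ^ n * 2 ^ n) (2 ^ n)
    (\<lambda>x. complex_of_real (schmidt_coeff c s n x)) (\<lambda>x. tensor_vec (hadamard_vec n x) (hadamard_vec n x))"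
proof (rule lincomb_vec_eqI[OF tensor_vec_closed[OF hadamard_vec_closed hadamard_vec_closed]])
  show "n_copies n (Psi p) \<in> carrier_vec (2 ^ n * 2 ^ n)" by (simp add: n_copies_def)
  fix r :: nat assume r: "r < 2 ^ n * 2 ^ n"
  let ?h = hadamard_entry and ?i = "bit_of (r div 2 ^ n)" and ?j = "bit_of (r mod 2 ^ n)"
  let ?g = "\<lambda>k b. complex_of_real (if b = 0 then c else s) * ?h b (?i k) * ?h b (?j k)"
  have "n_copies n (Psi p) $ r = (\<Prod>k<n. \<Sum>b<2. ?g k b)"
    using r by (simp add: n_copies_def Psi_index[OF assms(1,2) bit_of_less_2 bit_of_less_2 cs p])
  also have "\<dots> = (\<Sum>x<2 ^ n. \<Prod>k<n. ?g k (bit_of x k))"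
    unfolding sum_bit_of_prod[of ?g n] by (simp add: numeral_2_eq_2)
  also have "\<dots> = (\<Sum>x<2 ^ n. complex_of_real (schmidt_coeff c s n x) *
      tensor_vec (hadamard_vec n x) (hadamard_vec n x) $ r)"
  proof (intro sum.cong refl)
    fix x
    have "r div 2 ^ n < 2 ^ n" using r by (simp add: less_mult_imp_div_less)
    hence "tensor_vec (hadamard_vec n x) (hadamard_vec n x) $ r =
        (\<Prod>k<n. ?h (bit_of x k) (?i k)) * (\<Prod>k<n. ?h (bit_of x k) (?j k))"
      using r by (simp add: tensor_vec_index hadamard_vec_def)
    thus "(\<Prod>k<n. ?g k (bit_of x k)) = complex_of_real (schmidt_coeff c s n x) *
        tensor_vec (hadamard_vec n x) (hadamard_vec n x) $ r"
      by (simp add: schmidt_coeff_def prod.distrib)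
  qed
  finally show "n_copies n (Psi p) $ r = (\<Sum>x<2 ^ n. complex_of_real (schmidt_coeff c s n x) *
      tensor_vec (hadamard_vec n x) (hadamard_vec n x) $ r)" .
qed

section \<open>Comparison of the two CHSH values\<close>

text \<open>Reduces the claim to the numerical inequality \<open>gt\<close>. The permutation \<pi>
  lists the coefficients decreasingly; the same order provides the sorted Schmidt list and the
  pairing into blocks.\<close>

lemma chsh_exceeds_distillation:
  fixes c s :: real and n m :: nat and \<pi> :: "nat \<Rightarrow> nat" and \<alpha> \<beta> :: "nat \<Rightarrow> real"
  defines "\<mu> \<equiv> schmidt_coeff c s n"
  assumes s: "0 \<le> s" and sc: "s \<le> c" and cs: "c\<^sup>2 + s\<^sup>2 = 1"
    and \<pi>: "bij_betw \<pi> {..<2 ^ n} {..<2 ^ n}"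
    and mono: "\<And>i. Suc i < 2 ^ n \<Longrightarrow> \<mu> (\<pi> (Suc i)) \<le> \<mu> (\<pi> i)"
    and m: "2 ^ n = 2 * m" and unit: "\<And>j. j < m \<Longrightarrow> (\<alpha> j)\<^sup>2 + (\<beta> j)\<^sup>2 = 1"
    and gt: "2 + 4 * (sqrt 2 - 1) * (1 - c ^ (2 * n)) <
      (\<Sum>j<m. 2 * \<alpha> j * ((\<mu> (\<pi> (2 * j)))\<^sup>2 + (\<mu> (\<pi> (2 * j + 1)))\<^sup>2)
        + 4 * \<beta> j * (\<mu> (\<pi> (2 * j)) * \<mu> (\<pi> (2 * j + 1))))"
  shows "\<exists>p::real. 0 \<le> p \<and> p \<le> 1 \<and>
    (\<exists>A0 A1 B0 B1.
       pm1_observable n A0 \<and> pm1_observable n A1 \<and>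
       pm1_observable n B0 \<and> pm1_observable n B1 \<and>
       expectation_value (chsh_operator A0 A1 B0 B1) (n_copies n (Psi p)) > V_ED n p)"
proof -
  let ?d = "2 ^ n :: nat"
  define p where "p = (c + s)\<^sup>2 / 2"
  have p0: "0 \<le> p" by (simp add: p_def)
  have "(c + s)\<^sup>2 \<le> (c + s)\<^sup>2 + (c - s)\<^sup>2" by simp
  also have "\<dots> = 2 * (c\<^sup>2 + s\<^sup>2)" by (simp add: power2_eq_square algebra_simps)
  finally have p1: "p \<le> 1" by (simp add: p_def cs)
  define v where "v = n_copies n (Psi p)"
  define a where "a = hadamard_vec n \<circ> \<pi>"
  let ?\<mu> = "\<lambda>i. \<mu> (\<pi> i)"
  have vc: "v \<in> carrier_vec (?d * ?d)" by (simp add: v_def n_copies_def)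
  have \<pi>l: "\<pi> i < ?d" if "i < ?d" for i using bij_betwE[OF \<pi>] that by auto
  have \<pi>i: "\<pi> i = \<pi> j \<longleftrightarrow> i = j" if "i < ?d" "j < ?d" for i j
    using bij_betw_imp_inj_on[OF \<pi>] that by (auto simp: inj_on_def)
  have a: "orthonormal_family ?d a"
    using orthonormal_hadamard_vec[of n] \<pi>l \<pi>i by (auto simp: orthonormal_family_def a_def)
  note ac = orthonormal_family_closed[OF a]
  have v': "v = lincomb_vec (?d * ?d) ?d (\<lambda>x. complex_of_real (\<mu> x))
      (\<lambda>x. tensor_vec (hadamard_vec n x) (hadamard_vec n x))"
    unfolding v_def \<mu>_def by (rule n_copies_Psi_schmidt[OF s sc cs p_def])
  have v: "v = lincomb_vec (?d * ?d) ?d (\<lambda>i. complex_of_real (?\<mu> i)) (\<lambda>i. tensor_vec (a i) (a i))"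
  proof (rule lincomb_vec_eqI[OF tensor_vec_closed[OF ac ac] vc])
    fix r assume r: "r < ?d * ?d"
    have "v $ r = (\<Sum>x<?d. \<mu> x * tensor_vec (hadamard_vec n x) (hadamard_vec n x) $ r)"
      unfolding v' by (rule lincomb_vec_index[OF tensor_vec_closed[OF hadamard_vec_closed hadamard_vec_closed] r])
    also have "\<dots> = (\<Sum>i<?d. ?\<mu> i * tensor_vec (a i) (a i) $ r)"
      unfolding a_def comp_def
      by (rule sum.reindex_bij_betw[OF \<pi>, of "\<lambda>x. \<mu> x * tensor_vec (hadamard_vec n x) (hadamard_vec n x) $ r", symmetric])
    finally show "v $ r = (\<Sum>i<?d. ?\<mu> i * tensor_vec (a i) (a i) $ r)" .
  qed
  have \<mu>0: "0 \<le> \<mu> x" for x using s sc by (auto simp: \<mu>_def schmidt_coeff_def intro!: prod_nonneg)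
  \<comment> \<open>This explicit list shows that a sorted Schmidt decomposition exists, as
    \<open>distillation_prob_le\<close> requires, and also yields the norm of
    \<open>v\<close>.\<close>
  define l where "l = map (\<lambda>i. (?\<mu> i)\<^sup>2) [0..<?d]"
  have l: "schmidt_squares ?d v l"
    unfolding schmidt_squares_def
  proof (intro conjI exI)
    show "sorted_wrt (\<ge>) l"
      using mono \<mu>0 by (subst sorted_wrt_iff_nth_Suc_transp) (auto simp: l_def intro!: power_mono transpI)
    show "v = finsum_vec TYPE(complex) (?d * ?d)
        (\<lambda>i. complex_of_real (sqrt (l ! i)) \<cdot>\<^sub>v tensor_vec (a i) (a i)) {..<?d}"
      unfolding lincomb_vec_def[symmetric]
    proof (rule lincomb_vec_eqI[OF tensor_vec_closed[OF ac ac] vc])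
      fix r assume r: "r < ?d * ?d"
      have "v $ r = (\<Sum>i<?d. ?\<mu> i * tensor_vec (a i) (a i) $ r)"
        by (subst v) (rule lincomb_vec_index[OF tensor_vec_closed[OF ac ac] r])
      thus "v $ r = (\<Sum>i<?d. sqrt (l ! i) * tensor_vec (a i) (a i) $ r)"
        using \<mu>0 by (simp add: l_def)
    qed
  qed (use a in \<open>auto simp: l_def\<close>)
  have "(\<Sum>i<?d. l ! i) = (\<Sum>i<?d. (?\<mu> i)\<^sup>2)" by (simp add: l_def)
  also have "\<dots> = 1"
    using sum.reindex_bij_betw[OF \<pi>, of "\<lambda>x. (\<mu> x)\<^sup>2"] sum_schmidt_coeff_square[OF cs, of n]
    by (simp add: \<mu>_def)
  finally have norm: "v \<bullet>c v = 1" using sum_schmidt_squares[OF l] by simp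
  let ?h = "hadamard_vec n 0"
  have h: "?h \<bullet>c ?h = 1" using orthonormal_family_cscalar_prod[OF orthonormal_hadamard_vec, of 0 n 0] by simp
  \<comment> \<open>By orthonormality only \<open>x = 0\<close> survives; all its digits are 0, so
    its coefficient is \<open>c ^ n\<close>.\<close>
  have "v \<bullet>c tensor_vec ?h ?h = (\<Sum>x<?d. \<mu> x * (tensor_vec (hadamard_vec n x) (hadamard_vec n x) \<bullet>c tensor_vec ?h ?h))"
    unfolding v' by (rule cscalar_prod_lincomb_left)
      (rule tensor_vec_closed[OF hadamard_vec_closed hadamard_vec_closed])+
  also have "\<dots> = (\<Sum>x<?d. if x = 0 then complex_of_real (\<mu> x) else 0)"
    by (intro sum.cong refl)
      (auto simp: cscalar_prod_tensor_vec[OF hadamard_vec_closed hadamard_vec_closed hadamard_vec_closed hadamard_vec_closed]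
        orthonormal_family_cscalar_prod[OF orthonormal_hadamard_vec])
  also have "\<dots> = complex_of_real (c ^ n)" by (simp add: \<mu>_def schmidt_coeff_def bit_of_def)
  finally have "(cmod (v \<bullet>c tensor_vec ?h ?h))\<^sup>2 = c ^ (2 * n)"
    by (simp add: norm_power power_mult[symmetric] mult.commute power_even_abs)
  hence "p_succ n p \<le> 2 * (1 - c ^ (2 * n))"
    using distillation_prob_le[OF l norm hadamard_vec_closed h hadamard_vec_closed h]
    by (simp add: p_succ_def v_def)
  \<comment> \<open>\<open>V_ED\<close> equals 2 + 2 (sqrt 2 - 1) \<open>p_succ\<close>, which
    increases with the success probability.\<close>
  hence "2 * (sqrt 2 - 1) * p_succ n p \<le> 2 * (sqrt 2 - 1) * (2 * (1 - c ^ (2 * n)))"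
    by (intro mult_left_mono) auto
  hence V: "V_ED n p \<le> 2 + 4 * (sqrt 2 - 1) * (1 - c ^ (2 * n))"
    by (simp add: V_ED_def algebra_simps)
  obtain A0 A1 B0 B1 where
    obs: "pm1_observable n A0" "pm1_observable n A1" "pm1_observable n B0" "pm1_observable n B1" and
    "expectation_value (chsh_operator A0 A1 B0 B1) v =
       (\<Sum>j<m. 2 * \<alpha> j * ((?\<mu> (2 * j))\<^sup>2 + (?\<mu> (2 * j + 1))\<^sup>2) + 4 * \<beta> j * (?\<mu> (2 * j) * ?\<mu> (2 * j + 1)))"
    by (rule chsh_value_of_paired_schmidt_vectors[OF m unit a a v])
  hence "expectation_value (chsh_operator A0 A1 B0 B1) v > V_ED n p"
    using V gt by linarith
  thus ?thesis using p0 p1 obs unfolding v_def by blast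
qed

theorem theorem1:
  fixes n :: nat
  assumes "n \<in> {2, 3}"
  shows "\<exists>p::real. 0 \<le> p \<and> p \<le> 1 \<and>
    (\<exists>A0 A1 B0 B1.
       pm1_observable n A0 \<and> pm1_observable n A1 \<and>
       pm1_observable n B0 \<and> pm1_observable n B1 \<and>
       expectation_value (chsh_operator A0 A1 B0 B1) (n_copies n (Psi p)) > V_ED n p)"
proof -
  \<comment> \<open>A convergent of sqrt 2 from above, as 99^2 = 2 * 70^2 + 1; the distillation
    bound increases with sqrt 2, so an upper estimate is what is called for.\<close>
  have sqrt2: "sqrt 2 \<le> 99 / 70" by (rule real_le_lsqrt) (simp_all add: power2_eq_square)
  have coeff2: "schmidt_coeff c s 2 x = (if even x then c else s) * (if even (x div 2) then c else s)" for c s x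
    by (simp add: numeral_2_eq_2 schmidt_coeff_simps)
  have coeff3: "schmidt_coeff c s 3 x = (if even x then c else s) * (if even (x div 2) then c else s) *
      (if even (x div 4) then c else s)" for c s x
    by (simp add: numeral_3_eq_3 schmidt_coeff_simps flip: div_mult2_eq)
  text \<open>Rational points of the unit circle keep the arithmetic exact: \<open>(12, 5) / 13\<close> approximates the
    optimal direction \<open>(1, 2 c s)\<close> for an unequal block, \<open>(20, 21) / 29\<close> the direction \<open>(1, 1)\<close> for an
    equal one.\<close>
  from assms consider "n = 2" | "n = 3" by auto
  thus ?thesis
  proof cases
    case 1
    show ?thesis unfolding 1
    \<comment> \<open>The triple (9, 40, 41) makes s small. The coefficients c^2, cs, cs, s^2 are
      already in order. The values compared are about 2.1756 and 2.156. Writing \<open>m\<close>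
      with \<open>Suc\<close> lets the simplifier unroll the sum over the blocks.\<close>
    proof (rule chsh_exceeds_distillation[where c = "40/41" and s = "9/41" and \<pi> = id and m = "Suc (Suc 0)"
          and \<alpha> = "\<lambda>_. 12/13" and \<beta> = "\<lambda>_. 5/13"])
      show "schmidt_coeff (40/41) (9/41) 2 (id (Suc i)) \<le> schmidt_coeff (40/41) (9/41) 2 (id i)"
        if "Suc i < 2 ^ 2" for i
      proof -
        have "i \<in> {0, 1, 2}" using that by auto
        thus ?thesis by (auto simp: coeff2)
      qed
    qed (use sqrt2 in \<open>simp_all add: coeff2 power_divide\<close>)
  next
    case 2
    text \<open>The Schmidt vectors with one binary digit 1 are numbers 1, 2 and 4, hence the swap.\<close>
    let ?\<pi> = "id(3 := 4, 4 := 3 :: nat)"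
    show ?thesis unfolding 2
    \<comment> \<open>Blocks 0 and 3 are the unequal pairs (c^3, c^2 s) and (c s^2, s^3). Blocks 1
      and 2 are equal pairs, each contributing 4 (\<alpha> + \<beta>) \<mu>^2 with \<alpha> +
      \<beta> = 41/29 close to sqrt 2. The values compared are about 2.2354 and 2.2282.\<close>
    proof (rule chsh_exceeds_distillation[where c = "40/41" and s = "9/41" and \<pi> = ?\<pi> and m = "Suc (Suc (Suc (Suc 0)))"
          and \<alpha> = "\<lambda>j. if j \<in> {0, 3} then 12/13 else 20/29"
          and \<beta> = "\<lambda>j. if j \<in> {0, 3} then 5/13 else 21/29"])
      show "bij_betw ?\<pi> {..<2 ^ 3} {..<2 ^ 3}"
        by (rule bij_betw_byWitness[where f' = ?\<pi>]) auto
      show "schmidt_coeff (40/41) (9/41) 3 (?\<pi> (Suc i)) \<le> schmidt_coeff (40/41) (9/41) 3 (?\<pi> i)"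
        if "Suc i < 2 ^ 3" for i
      proof -
        have "i \<in> {0, 1, 2, 3, 4, 5, 6}" using that by auto
        thus ?thesis by (auto simp: coeff3)
      qed
    qed (use sqrt2 in \<open>simp_all add: coeff3 power_divide\<close>)
  qed
qed

end
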